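(* Let $\eta,\eta_1,\eta_2,\ldots$ be independent and identically distributed random variables supported on $\mathbb{Z}^+=\{0,1,2,\ldots\}$ with $q=\mathbb{E}[\eta]<1$, and assume that the second and third moments of $\eta$ exist as required by the expressions below. Let $\psi(m)$ be the infinite-horizon ruin probability, with initial value $m$, of the compound binomial risk process $U_t=m+t-\sum_{i=1}^t\eta_i$, $t=0,1,\ldots$. Then, for $m=1,2,\ldots$, $$\left(\frac{q-\mathbb{P}(\eta>0)}{\mathbb{P}(\eta=0)}\right)^m\leq\psi(m)\leq\left(\frac{q-\mathbb{P}(\eta>0)}{\mathbb{P}(\eta=0)}\right)^m+\frac{1}{\mathbb{P}(\eta=0)}\left(\frac12\mathbb{E}[\eta(\eta-1)]-q+\mathbb{P}(\eta>0)\right),$$ and $$\left|\psi(m)-\left(\frac{\mathbb{E}[\eta(\eta-1)]}{2(1-q)+\mathbb{E}[\eta(\eta-1)]}\right)^m\right|\leq\frac12\min\left\{1,\frac{(1-q)(1+v)}{\mathbb{P}(\eta=0)}\right\}\left(\frac{\mathbb{E}[\eta(\eta-1)(2\eta-1)]}{3\mathbb{E}[\eta(\eta-1)]}-1\right),$$ where $$v=\sqrt{\frac{-4(q-\mathbb{P}(\eta>0))}{(2q-3\mathbb{P}(\eta>0))\log\left(\frac{q-\mathbb{P}(\eta>0)}{\mathbb{P}(\eta=0)}\right)}}.$$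
   Context: The infinite-horizon ruin probability is $\psi(m)=\mathbb{P}(\tau<\infty\,|\,U_0=m)$, where $\tau=\min\{t\geq 1:U_t\leq 0\}$ (with $\tau=\infty$ if no such $t$ exists).
   Formalization: When 2q ≤ 3P(η>0), v is not a real number, and the minimum in the second display is then taken to be 1; the second display is stated only for E[η(η−1)] > 0, since otherwise its right-hand side is 0/0. *)

theory Defs
  imports "HOL-Probability.Probability" "HOL-Library.Extended_Nat"
begin

text \<open>A sequence \<open>\<eta>\<close> of random variables is indexed by all of \<open>nat\<close>:
  \<open>\<eta> 0\<close> is the generic copy (written without an index on paper), and the claims
  are \<open>\<eta> 1, \<eta> 2, \<dots>\<close>.\<close>

definition (in prob_space) iid_nat :: "(nat \<Rightarrow> 'a \<Rightarrow> nat) \<Rightarrow> bool" where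
  "iid_nat \<eta> \<longleftrightarrow>
     indep_vars (\<lambda>_. count_space UNIV) \<eta> UNIV \<and>
     (\<forall>i. distr M (count_space UNIV) (\<eta> i) = distr M (count_space UNIV) (\<eta> 0))"

definition risk_process :: "(nat \<Rightarrow> 'a \<Rightarrow> nat) \<Rightarrow> nat \<Rightarrow> nat \<Rightarrow> 'a \<Rightarrow> int" where
  "risk_process \<eta> m t \<omega> = int m + int t - (\<Sum>i=1..t. int (\<eta> i \<omega>))"

text \<open>The infimum of the empty set in \<open>enat\<close> is \<open>\<infinity>\<close>; a nonempty set attains its infimum.\<close>

definition ruin_time :: "(nat \<Rightarrow> 'a \<Rightarrow> nat) \<Rightarrow> nat \<Rightarrow> 'a \<Rightarrow> enat" where
  "ruin_time \<eta> m \<omega> = Inf {enat t | t. t \<ge> 1 \<and> risk_process \<eta> m t \<omega> \<le> 0}"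

text \<open>The initial value \<open>m\<close> is deterministic, so conditioning on it amounts to
  starting the process at \<open>m\<close>.\<close>

definition (in prob_space) ruin_probability :: "(nat \<Rightarrow> 'a \<Rightarrow> nat) \<Rightarrow> nat \<Rightarrow> real" where
  "ruin_probability \<eta> m = prob {\<omega> \<in> space M. ruin_time \<eta> m \<omega> < \<infinity>}"

text \<open>Convention for \<open>v = sqrt (-4 (q - p) / ((2 q - 3 p) ln ((q - p) / p\<^sub>0)))\<close>, where
  \<open>p = P(\<eta> > 0)\<close>, \<open>p\<^sub>0 = P(\<eta> = 0)\<close>: if \<open>q > p\<close>, the logarithm is negative, so \<open>v\<close> is
  a real number iff \<open>2 q > 3 p\<close>. For \<open>2 q \<le> 3 p\<close> we read \<open>v = \<infinity>\<close>, so that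
  \<open>min {1, (1 - q) (1 + v) / p\<^sub>0} = 1\<close>. The statement makes this case distinction
  explicitly, since in HOL \<open>x / 0 = 0\<close> and \<open>sqrt\<close> of a negative number is negative.\<close>

end

theory Submission
  imports Defs "HOL-Computational_Algebra.Formal_Power_Series"
begin

text \<open>Ruin means that the walk \<open>S t = (\<Sum>i=1..t. (\<eta> i - 1))\<close> has maximum at least \<open>m\<close>. With
  \<open>b k = P (\<eta> > k)\<close>, first-step analysis and summation by parts give the renewal equation
  \<open>\<psi> m = (\<Sum>k. b k * \<psi> (m - k))\<close>; a sign argument at finite horizons, where all boundary terms
  at infinity vanish, replaces the strong law of large numbers. So the maximum is a sum of
  geometrically many ladder heights, with parameter \<open>\<rho> = (q - p) / p\<^sub>0\<close>, and each of its masses is at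
  most \<open>1 - \<rho>\<close>. Both parts of the first claim follow by induction on \<open>m\<close>. For the geometric
  approximation, the difference of the two generating functions factors through the second
  iterated tail of \<open>b\<close>, whose mass is \<open>E [\<eta> (\<eta> - 1) (\<eta> - 2)] / 6\<close>; the resulting constant
  \<open>1 - \<rho> = (1 - q) / p\<^sub>0\<close> is sharper than the stated one.\<close>

section \<open>Iterated tails of summable sequences\<close>

text \<open>Dominated convergence for series: every exchange of a limit with an infinite sum below
  rests on it.\<close>

lemma tendsto_suminf_dominated:
  fixes a :: "nat \<Rightarrow> nat \<Rightarrow> real"
  assumes "\<And>k. (\<lambda>n. a n k) \<longlonglongrightarrow> c k" "\<And>n k. \<bar>a n k\<bar> \<le> B k" "summable B"
  shows "(\<lambda>n. \<Sum>k. a n k) \<longlonglongrightarrow> (\<Sum>k. c k)"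
  using tannerys_theorem[of "\<lambda>k n. a n k" c sequentially B] assms
  by (auto simp: case_prod_unfold)

text \<open>The inequality is strict, so for the masses of a claim this is P(claim >
  \<open>k\<close>).\<close>

definition tail :: "(nat \<Rightarrow> real) \<Rightarrow> nat \<Rightarrow> real" where
  "tail x k = (\<Sum>j. if k < j then x j else 0)"

lemma summable_restrict:
  fixes x :: "nat \<Rightarrow> real"
  assumes "\<And>j. x j \<ge> 0" "summable x"
  shows "summable (\<lambda>j. if P j then x j else 0)"
  by (rule summable_comparison_test'[OF assms(2)]) (use assms(1) in auto)

lemma tail_nonneg:
  assumes "\<And>j. x j \<ge> 0" "summable x"
  shows "tail x k \<ge> 0"
  unfolding tail_def by (intro suminf_nonneg summable_restrict) (use assms in auto)

lemma tail_0:
  assumes "\<And>j. x j \<ge> 0" "summable x"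
  shows "tail x 0 = suminf x - x 0"
proof -
  have "(\<lambda>j. x j - (if j = 0 then x j else 0)) sums (suminf x - x 0)"
    by (intro sums_diff summable_sums assms(2)) (use sums_single[of 0 x] in simp)
  also have "(\<lambda>j. x j - (if j = 0 then x j else 0)) = (\<lambda>j. if 0 < j then x j else 0)"
    by auto
  finally show ?thesis by (simp add: tail_def sums_iff)
qed

lemma tail_Suc:
  assumes "\<And>j. x j \<ge> 0" "summable x"
  shows "tail x (Suc k) = tail x k - x (Suc k)"
proof -
  have "(\<lambda>j. (if k < j then x j else 0) - (if j = Suc k then x j else 0)) sums (tail x k - x (Suc k))"
    unfolding tail_def by (intro sums_diff summable_sums summable_restrict assms) (rule sums_single)
  also have "(\<lambda>j. (if k < j then x j else 0) - (if j = Suc k then x j else 0))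
      = (\<lambda>j. if Suc k < j then x j else 0)"
    by auto
  finally show ?thesis by (simp add: tail_def sums_iff)
qed

text \<open>Tonelli for the nonnegative double series over \<open>k < j\<close>. With binomial
  weights it turns the masses of iterated tails into factorial moments.\<close>

lemma tail_weighted_sums:
  assumes x: "\<And>j. x j \<ge> 0" "summable x" and w: "\<And>k. w k \<ge> 0"
    and wx: "summable (\<lambda>j. (\<Sum>k<j. w k) * x j)"
  shows "(\<lambda>k. w k * tail x k) sums (\<Sum>j. (\<Sum>k<j. w k) * x j)"
proof -
  \<comment> \<open>With finitely many outer terms the exchange is elementary; the cutoff reappears
    as \<open>min n j\<close>, and the full weights dominate.\<close>
  have *: "(\<Sum>k<n. w k * tail x k) = (\<Sum>j. (\<Sum>k<min n j. w k) * x j)" for n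
  proof -
    have "(\<Sum>k<n. w k * tail x k) = (\<Sum>k<n. \<Sum>j. w k * (if k < j then x j else 0))"
      unfolding tail_def by (intro sum.cong refl suminf_mult[symmetric] summable_restrict x)
    also have "\<dots> = (\<Sum>j. \<Sum>k<n. w k * (if k < j then x j else 0))"
      by (intro suminf_sum[symmetric] summable_mult summable_restrict x)
    also have "\<dots> = (\<Sum>j. (\<Sum>k<min n j. w k) * x j)"
    proof (intro suminf_cong)
      fix j
      have "(\<Sum>k<n. w k * (if k < j then x j else 0)) = (\<Sum>k\<in>{k\<in>{..<n}. k < j}. w k * x j)"
        by (subst sum.inter_filter) (auto intro!: sum.cong)
      also have "{k\<in>{..<n}. k < j} = {..<min n j}" by auto
      finally show "(\<Sum>k<n. w k * (if k < j then x j else 0)) = (\<Sum>k<min n j. w k) * x j"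
        by (simp add: sum_distrib_right)
    qed
    finally show ?thesis .
  qed
  show ?thesis
    unfolding sums_def *
  proof (rule tendsto_suminf_dominated[OF _ _ wx])
    fix j
    have "eventually (\<lambda>n. (\<Sum>k<min n j. w k) * x j = (\<Sum>k<j. w k) * x j) sequentially"
      using eventually_ge_at_top[of j] by eventually_elim (simp add: min_def)
    then show "(\<lambda>n. (\<Sum>k<min n j. w k) * x j) \<longlonglongrightarrow> (\<Sum>k<j. w k) * x j"
      by (rule tendsto_eventually)
  next
    fix n j
    have "(\<Sum>k<min n j. w k) \<le> (\<Sum>k<j. w k)"
      by (intro sum_mono2) (use w in auto)
    then show "\<bar>(\<Sum>k<min n j. w k) * x j\<bar> \<le> (\<Sum>k<j. w k) * x j"
      using x(1)[of j] sum_nonneg[of "{..<min n j}" w] w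
      by (auto simp: abs_mult intro!: mult_mono)
  qed
qed

lemma tendsto_minus_const_nat:
  "h \<longlonglongrightarrow> L \<Longrightarrow> (\<lambda>m. h (m - k :: nat)) \<longlonglongrightarrow> L"
  by (rule filterlim_compose[OF _ filterlim_minus_const_nat_at_top])

section \<open>The renewal equation\<close>

text \<open>Truncated subtraction makes \<open>h 0\<close> stand for the value at every nonpositive level.\<close>

definition finite_ruin :: "(nat \<Rightarrow> real) \<Rightarrow> nat \<Rightarrow> nat \<Rightarrow> real" where
  "finite_ruin f n = ((\<lambda>h m. if m = 0 then 1 else \<Sum>k. f k * h (Suc m - k)) ^^ n)
     (\<lambda>m. if m = 0 then 1 else 0)"

lemma finite_ruin_0: "finite_ruin f 0 m = (if m = 0 then 1 else 0)"
  and finite_ruin_at_0 [simp]: "finite_ruin f n 0 = 1"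
  and finite_ruin_Suc: "m \<ge> 1 \<Longrightarrow> finite_ruin f (Suc n) m = (\<Sum>k. f k * finite_ruin f n (Suc m - k))"
  by (cases n; simp add: finite_ruin_def)+

lemma power_le_renewal_bound:
  fixes \<psi> :: "nat \<Rightarrow> real"
  assumes "antimono \<psi>" "\<psi> 0 = 1" "0 \<le> \<rho>"
    and "\<And>m. m \<ge> 1 \<Longrightarrow> \<rho> * \<psi> (m - 1) \<le> \<psi> m"
  shows "\<rho> ^ m \<le> \<psi> m"
proof (induction m)
  case (Suc m)
  have "\<rho> ^ Suc m \<le> \<rho> * \<psi> m"
    using Suc assms(3) by (simp add: mult_left_mono)
  also have "\<dots> \<le> \<psi> (Suc m)"
    using assms(4)[of "Suc m"] by simp
  finally show ?case .
qed (simp add: assms)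

text \<open>The analysis works with the masses and the mean of one claim alone; the probability
  space enters later.\<close>

locale claim_law =
  fixes f :: "nat \<Rightarrow> real" and q :: real
  assumes f_nonneg: "\<And>k. f k \<ge> 0"
    and f_sums: "f sums 1"
    and mean_sums: "(\<lambda>k. real k * f k) sums q"
    and q_less_1: "q < 1"
begin

abbreviation b :: "nat \<Rightarrow> real" where "b \<equiv> tail f"

lemma f_summable: "summable f" and f_suminf: "suminf f = 1"
  using f_sums by (auto simp: sums_iff)

lemma b_nonneg: "b k \<ge> 0"
  by (rule tail_nonneg[OF f_nonneg f_summable])

lemma b_sums: "b sums q"
  using tail_weighted_sums[of f "\<lambda>_. 1", OF f_nonneg f_summable] mean_sums
  by (auto simp: sums_iff)

lemma b_summable: "summable b" and b_suminf: "suminf b = q"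
  using b_sums by (auto simp: sums_iff)

lemma b_0: "b 0 = 1 - f 0"
  by (simp add: tail_0 f_nonneg f_summable f_suminf)

lemma b_0_le: "b 0 \<le> q"
  using sum_le_suminf[OF b_summable, of "{0}"] b_nonneg by (simp add: b_suminf)

text \<open>P(claim > 0) is one term of the series for the mean, which is below 1. This legitimates
  all divisions by \<open>f 0\<close>.\<close>

lemma f_0_pos: "f 0 > 0"
  using b_0_le q_less_1 b_0 by linarith

lemma dominated_summable:
  fixes x h :: "nat \<Rightarrow> real"
  assumes "summable x" "\<And>k. 0 \<le> x k" "\<And>k. 0 \<le> h k" "\<And>k. h k \<le> 1"
  shows "summable (\<lambda>k. x k * h k)"
  by (rule summable_comparison_test'[OF assms(1)])
    (use assms in \<open>simp add: abs_mult mult_left_le\<close>)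

text \<open>Summation by parts, from \<open>f k = b (k - 1) - b k\<close>.\<close>

lemma one_step_by_parts:
  assumes "\<And>k. 0 \<le> h k" "\<And>k. h k \<le> 1"
  shows "(\<Sum>k. f k * h (Suc m - k)) = h (Suc m) - (\<Sum>k. b k * h (Suc m - k)) + (\<Sum>k. b k * h (m - k))"
proof -
  have s: "summable (\<lambda>k. f k * h (j - k))" "summable (\<lambda>k. b k * h (j - k))" for j
    using assms by (auto intro!: dominated_summable f_summable b_summable f_nonneg b_nonneg)
  have "(\<Sum>k. f k * h (Suc m - k)) = f 0 * h (Suc m) + (\<Sum>k. f (Suc k) * h (m - k))"
    using suminf_split_head[OF s(1), of "Suc m"] by simp
  also have "(\<Sum>k. f (Suc k) * h (m - k)) = (\<Sum>k. b k * h (m - k) - b (Suc k) * h (m - k))"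
    by (intro suminf_cong) (simp add: tail_Suc f_nonneg f_summable algebra_simps)
  also have "\<dots> = (\<Sum>k. b k * h (m - k)) - (\<Sum>k. b (Suc k) * h (m - k))"
    using s(2)[of "Suc m", THEN summable_Suc_iff[THEN iffD2]]
    by (intro suminf_diff[symmetric] s) simp
  also have "(\<Sum>k. b (Suc k) * h (m - k)) = (\<Sum>k. b k * h (Suc m - k)) - b 0 * h (Suc m)"
    using suminf_split_head[OF s(2), of "Suc m"] by simp
  finally show ?thesis by (simp add: b_0 algebra_simps)
qed

section \<open>Ruin within a finite horizon\<close>

abbreviation \<phi> :: "nat \<Rightarrow> nat \<Rightarrow> real" where "\<phi> \<equiv> finite_ruin f"

lemma \<phi>_bounds: "0 \<le> \<phi> n m \<and> \<phi> n m \<le> 1"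
proof (induction n arbitrary: m)
  case (Suc n)
  show ?case
  proof (cases "m = 0")
    case False
    have s: "summable (\<lambda>k. f k * \<phi> n (Suc m - k))"
      using Suc by (intro dominated_summable f_summable f_nonneg) auto
    have "(\<Sum>k. f k * \<phi> n (Suc m - k)) \<le> (\<Sum>k. f k)"
      using Suc f_nonneg by (intro suminf_le s f_summable) (simp add: mult_left_le)
    moreover have "0 \<le> (\<Sum>k. f k * \<phi> n (Suc m - k))"
      using Suc f_nonneg by (intro suminf_nonneg s) simp
    ultimately show ?thesis using False by (simp add: finite_ruin_Suc f_suminf)
  qed simp
qed (simp add: finite_ruin_0)

lemma \<phi>_summable: "summable (\<lambda>k. f k * \<phi> n (m - k))" "summable (\<lambda>k. b k * \<phi> n (m - k))"
  using \<phi>_bounds by (auto intro!: dominated_summable f_summable f_nonneg b_summable b_nonneg)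

lemma \<phi>_antimono: "antimono (\<phi> n)"
proof (induction n)
  case (Suc n)
  show ?case
  proof (rule decseq_SucI)
    fix m show "\<phi> (Suc n) (Suc m) \<le> \<phi> (Suc n) m"
    proof (cases "m = 0")
      case False
      then show ?thesis
        using Suc f_nonneg
        by (simp add: finite_ruin_Suc del: diff_Suc_Suc)
           (intro suminf_le \<phi>_summable mult_left_mono antimonoD[OF Suc], auto)
    qed (use \<phi>_bounds in simp)
  qed
qed (auto simp: finite_ruin_0 antimono_def)

lemma \<phi>_incseq: "\<phi> n m \<le> \<phi> (Suc n) m"
proof (induction n arbitrary: m)
  case 0
  then show ?case using \<phi>_bounds by (simp add: finite_ruin_0)
next
  case (Suc n)
  show ?case
  proof (cases "m = 0")
    case False
    have "(\<Sum>k. f k * \<phi> n (Suc m - k)) \<le> (\<Sum>k. f k * \<phi> (Suc n) (Suc m - k))"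
      by (intro suminf_le \<phi>_summable mult_left_mono Suc f_nonneg)
    then show ?thesis using False by (simp add: finite_ruin_Suc)
  qed simp
qed

text \<open>For fixed \<open>k\<close> the argument \<open>m - k\<close> grows with
  \<open>m\<close>, and \<open>x\<close> dominates the terms.\<close>

lemma convolution_tendsto:
  fixes x h :: "nat \<Rightarrow> real"
  assumes "\<And>k. 0 \<le> h k" "\<And>k. h k \<le> 1" "h \<longlonglongrightarrow> L" "summable x" "\<And>k. 0 \<le> x k"
  shows "(\<lambda>m. \<Sum>k. x k * h (m - k)) \<longlonglongrightarrow> suminf x * L"
proof -
  have "(\<lambda>m. \<Sum>k. x k * h (m - k)) \<longlonglongrightarrow> (\<Sum>k. x k * L)"
    using assms
    by (intro tendsto_suminf_dominated[OF _ _ assms(4)] tendsto_mult_left tendsto_minus_const_nat)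
       (auto simp: abs_mult mult_left_le)
  then show ?thesis by (simp add: suminf_mult2[OF assms(4)])
qed

lemma \<phi>_tendsto_0: "\<phi> n \<longlonglongrightarrow> 0"
proof (induction n)
  case 0
  show ?case
    by (rule tendsto_eventually, rule eventually_sequentiallyI[of 1]) (simp add: finite_ruin_0)
next
  case (Suc n)
  have "(\<lambda>m. \<Sum>k. f k * \<phi> n (m - k)) \<longlonglongrightarrow> suminf f * 0"
    using convolution_tendsto[OF _ _ Suc f_summable f_nonneg] \<phi>_bounds by blast
  then have "(\<lambda>m. \<Sum>k. f k * \<phi> n (Suc m - k)) \<longlonglongrightarrow> 0"
    using LIMSEQ_Suc by fastforce
  then show ?case
    by (rule Lim_transform_eventually[OF _ eventually_sequentiallyI[of 1]])
       (auto simp: finite_ruin_Suc)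
qed

text \<open>Summation by parts gives
  \<open>g (m + 1) - g m = \<phi> (n + 1) m - \<phi> n m \<ge> 0\<close> for the gap
  \<open>g\<close> between the two sides. A gap that increases to 0 is never positive.\<close>

lemma \<phi>_le_renewal:
  assumes "m \<ge> 1"
  shows "\<phi> n m \<le> (\<Sum>k. b k * \<phi> n (m - k))"
proof -
  define g where "g m = \<phi> n m - (\<Sum>k. b k * \<phi> n (m - k))" for m
  have "g (m + i) \<le> g (m + Suc i)" for i
    using \<phi>_incseq[of n "m + i"] one_step_by_parts[of "\<phi> n" "m + i"] \<phi>_bounds assms
    by (simp add: g_def finite_ruin_Suc)
  then have "incseq (\<lambda>i. g (m + i))" by (intro incseq_SucI) simp
  moreover have "g \<longlonglongrightarrow> 0 - suminf b * 0"
    unfolding g_def using \<phi>_bounds b_summable b_nonneg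
    by (intro tendsto_diff \<phi>_tendsto_0 convolution_tendsto) auto
  then have "(\<lambda>i. g (m + i)) \<longlonglongrightarrow> 0"
    using LIMSEQ_ignore_initial_segment[of g 0 m] by (simp add: add.commute)
  ultimately have "g (m + 0) \<le> 0" by (rule incseq_le)
  then show ?thesis by (simp add: g_def)
qed

section \<open>Passage to the infinite horizon\<close>

text \<open>This becomes the ruin probability for \<open>m \<ge> 1\<close>. The value 1 at level 0
  is a convention: ruin counts from time 1 on, so the true value there can be smaller.\<close>

definition \<Psi> :: "nat \<Rightarrow> real" where "\<Psi> m = lim (\<lambda>n. \<phi> n m)"

lemma \<Psi>_tendsto: "(\<lambda>n. \<phi> n m) \<longlonglongrightarrow> \<Psi> m"
proof -
  have "incseq (\<lambda>n. \<phi> n m)" by (intro incseq_SucI \<phi>_incseq)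
  then have "convergent (\<lambda>n. \<phi> n m)"
    using \<phi>_bounds by (metis incseq_convergent convergentI)
  then show ?thesis by (simp add: \<Psi>_def convergent_LIMSEQ_iff)
qed

lemma \<Psi>_0 [simp]: "\<Psi> 0 = 1"
  using \<Psi>_tendsto[of 0] by (simp add: LIMSEQ_const_iff)

lemma \<Psi>_nonneg: "0 \<le> \<Psi> m" and \<Psi>_le_1: "\<Psi> m \<le> 1"
  using \<phi>_bounds by (auto intro: LIMSEQ_le_const[OF \<Psi>_tendsto] LIMSEQ_le_const2[OF \<Psi>_tendsto])

lemma \<Psi>_antimono: "antimono \<Psi>"
  using \<phi>_antimono by (auto simp: antimono_def intro: LIMSEQ_le[OF \<Psi>_tendsto \<Psi>_tendsto])

lemma \<Psi>_summable: "summable (\<lambda>k. b k * \<Psi> (m - k))"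
  using \<Psi>_nonneg \<Psi>_le_1 by (auto intro!: dominated_summable b_summable b_nonneg)

lemma convolution_\<phi>_tendsto:
  fixes x :: "nat \<Rightarrow> real"
  assumes "summable x" "\<And>k. 0 \<le> x k"
  shows "(\<lambda>n. \<Sum>k. x k * \<phi> n (m - k)) \<longlonglongrightarrow> (\<Sum>k. x k * \<Psi> (m - k))"
  using assms \<phi>_bounds
  by (intro tendsto_suminf_dominated[OF _ _ assms(1)] tendsto_mult_left \<Psi>_tendsto)
     (auto simp: abs_mult mult_left_le)

text \<open>The gap is at most 0 as a limit of finite-horizon gaps. It is also constant in the
  level, because \<open>\<Psi>\<close> solves the one-step equation exactly, and its limit at
  infinity is nonnegative.\<close>

lemma \<Psi>_renewal:
  assumes "m \<ge> 1"
  shows "\<Psi> m = (\<Sum>k. b k * \<Psi> (m - k))"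
proof -
  define g where "g m = \<Psi> m - (\<Sum>k. b k * \<Psi> (m - k))" for m
  have g_le: "g m \<le> 0" if "m \<ge> 1" for m
    using LIMSEQ_le[OF \<Psi>_tendsto convolution_\<phi>_tendsto[OF b_summable b_nonneg]] \<phi>_le_renewal[OF that]
    by (auto simp: g_def)
  have "\<Psi> m = (\<Sum>k. f k * \<Psi> (Suc m - k))" if "m \<ge> 1" for m
    using LIMSEQ_Suc[OF \<Psi>_tendsto[of m]] convolution_\<phi>_tendsto[OF f_summable f_nonneg, of "Suc m"]
      LIMSEQ_unique that by (simp add: finite_ruin_Suc del: diff_Suc_Suc) blast
  then have step: "g (Suc m) = g m" if "m \<ge> 1" for m
    using one_step_by_parts[of \<Psi> m] \<Psi>_nonneg \<Psi>_le_1 that by (simp add: g_def)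
  \<comment> \<open>A constant equals its limit, here \<open>(1 - q) * L\<close> with
    \<open>L \<ge> 0\<close> the limit of \<open>\<Psi>\<close>.\<close>
  have const: "g (m + i) = g m" for i
    by (induction i) (use step assms in auto)
  have "\<exists>L. \<Psi> \<longlonglongrightarrow> L \<and> 0 \<le> L"
    using decseq_convergent[OF \<Psi>_antimono, of 0] \<Psi>_nonneg by (metis LIMSEQ_le_const)
  then obtain L where L: "\<Psi> \<longlonglongrightarrow> L" "0 \<le> L" by blast
  have "g \<longlonglongrightarrow> L - suminf b * L"
    unfolding g_def using \<Psi>_nonneg \<Psi>_le_1 b_summable b_nonneg
    by (intro tendsto_diff L convolution_tendsto) auto
  then have "(\<lambda>i. g (m + i)) \<longlonglongrightarrow> L - q * L"
    using LIMSEQ_ignore_initial_segment[of g _ m] by (simp add: add.commute b_suminf)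
  then have "g m = (1 - q) * L" by (simp only: const LIMSEQ_const_iff) (simp add: algebra_simps)
  then have "g m \<ge> 0" using L q_less_1 by simp
  with g_le[OF assms] show ?thesis by (simp add: g_def)
qed

section \<open>Comparison with geometric laws\<close>

text \<open>The total mass of the strict ladder heights \<open>b (Suc k) / f 0\<close>, that is, the
  probability that the walk ever exceeds 0.\<close>

definition \<rho> :: real where "\<rho> = (q - b 0) / f 0"

lemma \<rho>_nonneg: "0 \<le> \<rho>" and \<rho>_less_1: "\<rho> < 1" and one_minus_\<rho>: "1 - \<rho> = (1 - q) / f 0"
  using f_0_pos b_0_le b_0 q_less_1 by (auto simp: \<rho>_def field_simps)

text \<open>The masses of the overall maximum of the walk; they form a defective renewal sequence
  with step law \<open>b\<close>.\<close>

definition w :: "nat \<Rightarrow> real" where "w j = \<Psi> j - \<Psi> (Suc j)"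

lemma w_nonneg: "0 \<le> w j"
  using antimonoD[OF \<Psi>_antimono, of j "Suc j"] by (simp add: w_def)

lemma b_split: "(\<Sum>k. b (Suc k)) = q - b 0"
  using suminf_split_head[OF b_summable] by (simp add: b_suminf)

text \<open>Moving the ladder step of height 0 to the left passes from weak to strict ladder
  heights, as \<open>1 - b 0 = f 0\<close>.\<close>

lemma \<Psi>_renewal_Suc: "f 0 * \<Psi> (Suc m) = (\<Sum>k. b (Suc k) * \<Psi> (m - k))"
  using \<Psi>_renewal[of "Suc m"] suminf_split_head[OF \<Psi>_summable, of "Suc m"]
  by (simp add: b_0 algebra_simps)

lemma w_0: "w 0 = 1 - \<rho>"
  using \<Psi>_renewal_Suc[of 0] f_0_pos by (simp add: w_def b_split \<rho>_def field_simps)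

lemma w_renewal: "w (Suc j) = (\<Sum>k\<le>Suc j. b k * w (Suc j - k))"
proof -
  have "w (Suc j) = (\<Sum>k. b k * \<Psi> (Suc j - k)) - (\<Sum>k. b k * \<Psi> (Suc (Suc j) - k))"
    using \<Psi>_renewal[of "Suc j"] \<Psi>_renewal[of "Suc (Suc j)"] by (simp add: w_def)
  also have "\<dots> = (\<Sum>k. b k * \<Psi> (Suc j - k) - b k * \<Psi> (Suc (Suc j) - k))"
    by (intro suminf_diff \<Psi>_summable)
  \<comment> \<open>For \<open>k > Suc j\<close> both arguments truncate to 0, and the terms
    cancel.\<close>
  also have "\<dots> = (\<Sum>k\<le>Suc j. b k * \<Psi> (Suc j - k) - b k * \<Psi> (Suc (Suc j) - k))"
    by (intro suminf_finite) (auto simp: not_le)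
  also have "\<dots> = (\<Sum>k\<le>Suc j. b k * w (Suc j - k))"
    by (intro sum.cong refl) (simp add: w_def Suc_diff_le algebra_simps)
  finally show ?thesis .
qed

text \<open>In strict ladder form each later mass is a combination of earlier ones with total weight
  at most \<open>\<rho> < 1\<close>, so none exceeds \<open>w 0\<close>.\<close>

lemma w_le: "w j \<le> 1 - \<rho>"
proof (induction j rule: less_induct)
  case (less j)
  show ?case
  proof (cases j)
    case (Suc i)
    have "f 0 * w (Suc i) = (\<Sum>k\<le>i. b (Suc k) * w (i - k))"
      using w_renewal[of i] by (subst (asm) sum.atMost_Suc_shift) (simp add: b_0 algebra_simps)
    also have "\<dots> \<le> (\<Sum>k\<le>i. b (Suc k) * (1 - \<rho>))"
      using less Suc b_nonneg by (intro sum_mono mult_left_mono) auto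
    also have "\<dots> \<le> (q - b 0) * (1 - \<rho>)"
      using sum_le_suminf[of "\<lambda>k. b (Suc k)" "{..i}"] b_summable b_nonneg \<rho>_less_1
      by (auto simp: b_split summable_Suc_iff simp flip: sum_distrib_right intro!: mult_right_mono)
    also have "\<dots> \<le> f 0 * (1 - \<rho>)"
      using b_0 q_less_1 \<rho>_less_1 by (intro mult_right_mono) auto
    finally show ?thesis using f_0_pos Suc by simp
  qed (simp add: w_0)
qed

text \<open>Monotonicity bounds each \<open>\<Psi> (i - k)\<close> in the strict renewal equation
  below by \<open>\<Psi> i\<close>, so one level up costs at most a factor
  \<open>\<rho>\<close>.\<close>

lemma power_le_\<Psi>: "\<rho> ^ m \<le> \<Psi> m"
proof (rule power_le_renewal_bound[OF \<Psi>_antimono \<Psi>_0 \<rho>_nonneg])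
  fix m :: nat assume "m \<ge> 1"
  then obtain i where i: "m = Suc i" by (cases m) auto
  have s: "summable (\<lambda>k. b (Suc k))" using b_summable by (simp add: summable_Suc_iff)
  have "f 0 * (\<rho> * \<Psi> i) = (\<Sum>k. b (Suc k)) * \<Psi> i"
    using f_0_pos by (simp add: b_split \<rho>_def)
  also have "\<dots> = (\<Sum>k. b (Suc k) * \<Psi> i)"
    using s by (rule suminf_mult2)
  also have "\<dots> \<le> (\<Sum>k. b (Suc k) * \<Psi> (i - k))"
    using \<Psi>_nonneg \<Psi>_le_1
    by (intro suminf_le mult_left_mono antimonoD[OF \<Psi>_antimono] dominated_summable s b_nonneg) auto
  also have "\<dots> = f 0 * \<Psi> m" by (simp add: \<Psi>_renewal_Suc i)
  finally show "\<rho> * \<Psi> (m - 1) \<le> \<Psi> m" using f_0_pos i by simp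
qed

text \<open>Each level down adds one mass \<open>w l\<close>, and nothing once level 0 is
  reached.\<close>

lemma \<Psi>_increment_le: "\<Psi> (i - k) \<le> \<Psi> i + real k * (1 - \<rho>)"
proof (induction k)
  case (Suc k)
  show ?case
  proof (cases "i - k")
    case 0
    then show ?thesis using Suc \<rho>_less_1 by (simp add: algebra_simps)
  next
    case (Suc l)
    then have "i - Suc k = l" by simp
    with Suc have "\<Psi> (i - Suc k) = \<Psi> (i - k) + w l" by (simp add: w_def)
    then show ?thesis using w_le[of l] Suc.IH by (simp add: algebra_simps)
  qed
qed simp

text \<open>Replacing \<open>\<Psi> (m - k)\<close> by \<open>\<Psi> m\<close> in the strict renewal
  equation costs at most \<open>k * (1 - \<rho>)\<close>. Averaged over ladder heights, this is
  \<open>(1 - \<rho>) * K\<close>.\<close>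

lemma \<Psi>_upper:
  assumes "summable (\<lambda>k. real k * b k)"
  shows "\<Psi> m \<le> \<rho> ^ m + ((\<Sum>k. real k * b k) - q + b 0) / f 0"
proof -
  define K where "K = (\<Sum>k. real k * b (Suc k)) / f 0"
  have s1: "summable (\<lambda>k. b (Suc k))" using b_summable by (simp add: summable_Suc_iff)
  have "summable (\<lambda>k. real (Suc k) * b (Suc k) - b (Suc k))"
    using assms by (intro summable_diff s1) (simp add: summable_Suc_iff[of "\<lambda>k. real k * b k"] del: of_nat_Suc)
  then have s: "summable (\<lambda>k. real k * b (Suc k))" by (simp add: algebra_simps)
  have "(\<Sum>k. real k * b k) = (\<Sum>k. real (Suc k) * b (Suc k))"
    using suminf_split_head[OF assms] by simp
  also have "\<dots> = (\<Sum>k. real k * b (Suc k) + b (Suc k))"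
    by (simp add: algebra_simps)
  also have "\<dots> = K * f 0 + (q - b 0)"
    using suminf_add[OF s s1] f_0_pos by (simp add: K_def b_split)
  finally have K: "((\<Sum>k. real k * b k) - q + b 0) / f 0 = K" using f_0_pos by simp
  \<comment> \<open>The right side is the exact solution of
    \<open>x (m + 1) = \<rho> * x m + (1 - \<rho>) * K\<close> with \<open>x 0 = 1\<close>.\<close>
  have "\<Psi> m \<le> \<rho> ^ m + (1 - \<rho> ^ m) * K"
  proof (induction m)
    case (Suc m)
    have "f 0 * \<Psi> (Suc m) = (\<Sum>k. b (Suc k) * \<Psi> (m - k))" by (rule \<Psi>_renewal_Suc)
    also have "\<dots> \<le> (\<Sum>k. b (Suc k) * \<Psi> m + (1 - \<rho>) * (real k * b (Suc k)))"
    proof (intro suminf_le summable_add summable_mult summable_mult2 s s1)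
      show "b (Suc k) * \<Psi> (m - k) \<le> b (Suc k) * \<Psi> m + (1 - \<rho>) * (real k * b (Suc k))" for k
        using mult_left_mono[OF \<Psi>_increment_le[of m k] b_nonneg[of "Suc k"]] by (simp add: algebra_simps)
      show "summable (\<lambda>k. b (Suc k) * \<Psi> (m - k))"
        using \<Psi>_nonneg \<Psi>_le_1 by (intro dominated_summable s1 b_nonneg)
    qed
    also have "\<dots> = (\<Sum>k. b (Suc k)) * \<Psi> m + (1 - \<rho>) * (\<Sum>k. real k * b (Suc k))"
      by (simp add: suminf_add[symmetric] summable_mult summable_mult2 s s1 suminf_mult suminf_mult2)
    also have "\<dots> = f 0 * (\<rho> * \<Psi> m + (1 - \<rho>) * K)"
      using f_0_pos by (simp add: K_def \<rho>_def b_split field_simps)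
    finally have "\<Psi> (Suc m) \<le> \<rho> * \<Psi> m + (1 - \<rho>) * K" using f_0_pos by simp
    also have "\<dots> \<le> \<rho> * (\<rho> ^ m + (1 - \<rho> ^ m) * K) + (1 - \<rho>) * K"
      using Suc \<rho>_nonneg by (simp add: mult_left_mono)
    also have "\<dots> = \<rho> ^ Suc m + (1 - \<rho> ^ Suc m) * K" by (simp add: algebra_simps)
    finally show ?case .
  qed simp
  moreover have "(1 - \<rho> ^ m) * K \<le> 1 * K"
    using f_0_pos b_nonneg \<rho>_nonneg by (intro mult_right_mono) (auto simp: K_def intro!: divide_nonneg_nonneg suminf_nonneg s)
  ultimately show ?thesis unfolding K by simp
qed

section \<open>Generating functions and the geometric approximation\<close>

text \<open>On generating functions, taking tails is the divided difference (x(1) - x(z)) / (1 -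
  z).\<close>

lemma one_minus_X_mult_tail:
  fixes x :: "nat \<Rightarrow> real"
  assumes "\<And>j. x j \<ge> 0" "summable x"
  shows "(1 - fps_X) * Abs_fps (tail x) = fps_const (suminf x) - Abs_fps x"
proof (rule fps_ext)
  fix n show "fps_nth ((1 - fps_X) * Abs_fps (tail x)) n = fps_nth (fps_const (suminf x) - Abs_fps x) n"
    by (cases n) (simp_all add: left_diff_distrib tail_0 tail_Suc assms)
qed

lemma tail_b_sums:
  assumes "summable (\<lambda>k. real k * b k)"
  shows "tail b sums (\<Sum>k. real k * b k)"
  using tail_weighted_sums[of b "\<lambda>_. 1", OF b_nonneg b_summable] assms by simp

text \<open>With \<open>W\<close> and \<open>G\<close> the generating functions of the maximum and of the geometric law of
  the same mean, \<open>B\<close> and \<open>C\<close> those of the iterated tails of \<open>b\<close>, and \<open>D\<close> that of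
  \<open>\<lambda>m. \<Psi> (m + 1) - r ^ (m + 1)\<close>, the identity \<open>s D = C (W G - W)\<close> holds, and both \<open>W\<close> and
  \<open>W G\<close> have coefficients between \<open>0\<close> and \<open>1 - \<rho>\<close>.\<close>

lemma \<Psi>_geometric:
  assumes kb: "summable (\<lambda>k. real k * b k)" and C_summable: "summable (tail (tail b))"
    and s: "s = (\<Sum>k. real k * b k)" "s > 0"
    and r: "r = s / (1 - q + s)"
    and "m \<ge> 1"
  shows "\<bar>\<Psi> m - r ^ m\<bar> \<le> (1 - \<rho>) * suminf (tail (tail b)) / s"
proof -
  define W where "W = Abs_fps w"
  define B where "B = Abs_fps (tail b)"
  define C where "C = Abs_fps (tail (tail b))"
  define G where "G = Abs_fps (\<lambda>j. (1 - r) * r ^ j)"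
  define D where "D = Abs_fps (\<lambda>j. \<Psi> (Suc j) - r ^ Suc j)"
  define X :: "real fps" where "X = 1 - fps_X"
  define s' q' where "s' = fps_const s" and "q' = fps_const (1 - q)"
  have q0: "1 - q > 0" using q_less_1 by simp
  have r01: "0 \<le> r" "r \<le> 1" using q0 s by (auto simp: r)
  have tb: "summable (tail b)" "suminf (tail b) = s"
    using tail_b_sums[OF kb] s by (auto simp: sums_iff)
  have tb_nonneg: "tail b k \<ge> 0" for k by (rule tail_nonneg[OF b_nonneg b_summable])
  have C_nonneg: "tail (tail b) k \<ge> 0" for k by (rule tail_nonneg[OF tb_nonneg tb(1)])
  have XC: "X * C = s' - B"
    unfolding X_def B_def C_def s'_def one_minus_X_mult_tail[OF tb_nonneg tb(1)] tb(2) ..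
  have XB: "X * B = fps_const q - Abs_fps b"
    unfolding X_def B_def one_minus_X_mult_tail[OF b_nonneg b_summable] b_suminf ..
  \<comment> \<open>The renewal equation for \<open>w\<close>; the constant term is
    \<open>(1 - \<rho>) * f 0 = 1 - q\<close>.\<close>
  have "W * (1 - Abs_fps b) = q'"
  proof (rule fps_ext)
    fix n
    show "fps_nth (W * (1 - Abs_fps b)) n = fps_nth q' n"
    proof (cases n)
      case 0
      then show ?thesis using one_minus_\<rho> f_0_pos by (simp add: W_def q'_def w_0 b_0 field_simps)
    next
      case (Suc j)
      have "fps_nth (Abs_fps b * W) n = w n"
        unfolding W_def Suc w_renewal by (simp only: fps_mult_nth fps_nth_Abs_fps atLeast0AtMost)
      then have "fps_nth (W - Abs_fps b * W) n = 0" by (simp add: W_def)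
      moreover have "W * (1 - Abs_fps b) = W - Abs_fps b * W" by (simp add: algebra_simps)
      ultimately show ?thesis using Suc by (simp add: q'_def)
    qed
  qed
  also have "1 - Abs_fps b = q' + X * B"
    unfolding XB q'_def by (simp flip: fps_const_add fps_const_sub)
  finally have W: "W * (q' + X * B) = q'" .
  \<comment> \<open>The equation for \<open>W\<close> with \<open>B\<close> replaced by its value
    \<open>s\<close> at 1, which dictates the choice of \<open>r\<close>.\<close>
  have G: "G * (q' + s' * X) = q'"
  proof (rule fps_ext)
    fix n
    have *: "fps_const (1 - q + s) = q' + s'" by (simp add: q'_def s'_def)
    have "G * (q' + s' * X) = G * (q' + s') - s' * (fps_X * G)"
      by (simp add: X_def algebra_simps)
    then have "G * (q' + s' * X) = G * fps_const (1 - q + s) - fps_const s * (fps_X * G)"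
      unfolding * s'_def[symmetric] .
    moreover have "(1 - r) * (1 - q + s) = 1 - q" "r * (1 - q + s) = s"
      using q0 s(2) by (auto simp: r field_simps)
    then have "(1 - r) * r ^ Suc j * (1 - q + s) = s * ((1 - r) * r ^ j)" for j
      by (metis mult.assoc mult.commute power_Suc)
    ultimately show "fps_nth (G * (q' + s' * X)) n = fps_nth q' n"
      using \<open>(1 - r) * (1 - q + s) = 1 - q\<close>
      by (cases n) (simp_all add: G_def q'_def)
  qed
  have D: "X * D = G - W"
  proof (rule fps_ext)
    fix n
    show "fps_nth (X * D) n = fps_nth (G - W) n"
      by (cases n) (simp_all add: X_def D_def G_def W_def w_def algebra_simps)
  qed
  have "q' \<noteq> 0" using q0 by (simp add: q'_def)
  have "X \<noteq> 0"
  proof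
    assume "X = 0"
    then have "fps_nth X 0 = 0" by simp
    then show False by (simp add: X_def)
  qed
  \<comment> \<open>By the equations for \<open>W\<close> and \<open>G\<close>, both sides equal
    \<open>s' * G * W * X * B\<close>.\<close>
  have "q' * (s' * G * (1 - W)) = q' * (B * W * (1 - G))"
  proof -
    have "q' * (1 - W) = W * X * B" using W by (simp add: algebra_simps)
    then have "q' * (s' * G * (1 - W)) = s' * G * (W * X * B)"
      by (simp only: mult.left_commute[of q' "s' * G"])
    moreover have "q' * (1 - G) = G * (s' * X)" using G by (simp add: algebra_simps)
    then have "q' * (B * W * (1 - G)) = B * W * (G * (s' * X))"
      by (simp only: mult.left_commute[of q' "B * W"])
    ultimately show ?thesis by (simp only: mult_ac)
  qed
  then have key: "s' * G * (1 - W) = B * W * (1 - G)" using \<open>q' \<noteq> 0\<close> by simp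
  have "X * (s' * D) = s' * (X * D)" by (rule mult.left_commute)
  also have "\<dots> = s' * (G - W)" unfolding D ..
  also have "\<dots> = (s' - B) * (W * G - W)" using key by (simp add: algebra_simps)
  also have "\<dots> = X * (C * (W * G - W))" by (simp flip: XC add: mult.assoc)
  finally have sD: "s' * D = C * (W * G - W)" using \<open>X \<noteq> 0\<close> by simp
  have WG: "0 \<le> fps_nth (W * G) n \<and> fps_nth (W * G) n \<le> 1 - \<rho>" for n
  proof -
    have "(\<Sum>i\<le>n. (1 - r) * r ^ (n - i)) = (\<Sum>i\<le>n. (1 - r) * r ^ i)"
      by (rule sum.reindex_bij_witness[of _ "\<lambda>i. n - i" "\<lambda>i. n - i"]) auto
    also have "\<dots> = 1 - r ^ Suc n"
      using one_diff_power_eq[of r "Suc n"] by (simp add: sum_distrib_left lessThan_Suc_atMost)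
    finally have G_le: "(\<Sum>i\<le>n. (1 - r) * r ^ (n - i)) \<le> 1" using r01 by simp
    have "(\<Sum>i\<le>n. w i * ((1 - r) * r ^ (n - i))) \<le> (\<Sum>i\<le>n. (1 - \<rho>) * ((1 - r) * r ^ (n - i)))"
      using r01 w_le by (intro sum_mono mult_right_mono) auto
    also have "\<dots> = (1 - \<rho>) * (\<Sum>i\<le>n. (1 - r) * r ^ (n - i))"
      by (rule sum_distrib_left[symmetric])
    also have "\<dots> \<le> (1 - \<rho>) * 1"
      by (rule mult_left_mono[OF G_le]) (use \<rho>_less_1 in simp)
    finally show ?thesis
      using r01 w_nonneg by (auto simp: fps_mult_nth W_def G_def atLeast0AtMost intro!: sum_nonneg)
  qed
  \<comment> \<open>Two numbers from the interval between 0 and \<open>1 - \<rho>\<close> differ by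
    at most its length, which avoids a factor 2.\<close>
  have E: "\<bar>fps_nth (W * G - W) n\<bar> \<le> 1 - \<rho>" for n
    using WG[of n] w_nonneg[of n] w_le[of n] by (auto simp: W_def abs_le_iff)
  have "s * \<bar>fps_nth D n\<bar> = \<bar>fps_nth (s' * D) n\<bar>" for n
    using s by (simp add: s'_def abs_mult)
  also have "\<bar>fps_nth (s' * D) n\<bar> \<le> (\<Sum>i\<le>n. \<bar>tail (tail b) i * fps_nth (W * G - W) (n - i)\<bar>)" for n
    unfolding sD fps_mult_nth[of C] by (simp add: C_def atLeast0AtMost sum_abs del: fps_sub_nth)
  also have "(\<Sum>i\<le>n. \<bar>tail (tail b) i * fps_nth (W * G - W) (n - i)\<bar>)
      \<le> (\<Sum>i\<le>n. tail (tail b) i * (1 - \<rho>))" for n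
    by (intro sum_mono) (simp add: abs_mult C_nonneg mult_left_mono E del: fps_sub_nth)
  also have "(\<Sum>i\<le>n. tail (tail b) i * (1 - \<rho>)) \<le> suminf (tail (tail b)) * (1 - \<rho>)" for n
    unfolding sum_distrib_right[symmetric] using \<rho>_less_1 C_nonneg C_summable
    by (intro mult_right_mono sum_le_suminf) auto
  finally have "s * \<bar>fps_nth D n\<bar> \<le> suminf (tail (tail b)) * (1 - \<rho>)" for n .
  from this[of "m - 1"] have "s * \<bar>\<Psi> m - r ^ m\<bar> \<le> suminf (tail (tail b)) * (1 - \<rho>)"
    using \<open>m \<ge> 1\<close> by (cases m) (auto simp: D_def)
  then show ?thesis using s(2) by (simp add: field_simps)
qed

end
section \<open>Ruin probabilities\<close>

context prob_space
begin

section \<open>Events determined by finitely many claims\<close>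

context
  fixes X :: "nat \<Rightarrow> 'a \<Rightarrow> nat"
  assumes indep: "indep_vars (\<lambda>_. count_space UNIV) X UNIV"
begin

text \<open>A finite product of countable discrete spaces is discrete, so any predicate on finitely
  many claims is measurable.\<close>

lemma finite_dim_events:
  assumes "finite A"
  shows "{\<omega>\<in>space M. P (restrict (\<lambda>i. X i \<omega>) A)} \<in> events"
proof -
  have [measurable]: "X i \<in> measurable M (count_space UNIV)" for i
    using indep by (auto simp: indep_vars_def)
  have "(\<lambda>\<omega>. restrict (\<lambda>i. X i \<omega>) A) \<in> measurable M (PiM A (\<lambda>_. count_space UNIV))"
    by measurable
  then have "(\<lambda>\<omega>. restrict (\<lambda>i. X i \<omega>) A) \<in> measurable M (count_space (PiE A (\<lambda>_. UNIV)))"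
    using assms by (simp add: count_space_PiM_finite)
  then have "(\<lambda>\<omega>. restrict (\<lambda>i. X i \<omega>) A) -` {x \<in> PiE A (\<lambda>_. UNIV). P x} \<inter> space M \<in> events"
    by (rule measurable_sets) auto
  also have "(\<lambda>\<omega>. restrict (\<lambda>i. X i \<omega>) A) -` {x \<in> PiE A (\<lambda>_. UNIV). P x} \<inter> space M
      = {\<omega>\<in>space M. P (restrict (\<lambda>i. X i \<omega>) A)}"
    by auto
  finally show ?thesis .
qed

lemma finite_dim_indep:
  assumes "finite A" "finite B" "A \<inter> B = {}"
  shows "prob {\<omega>\<in>space M. P (restrict (\<lambda>i. X i \<omega>) A) \<and> Q (restrict (\<lambda>i. X i \<omega>) B)}
    = prob {\<omega>\<in>space M. P (restrict (\<lambda>i. X i \<omega>) A)} * prob {\<omega>\<in>space M. Q (restrict (\<lambda>i. X i \<omega>) B)}"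
proof -
  have eq: "PiM C (\<lambda>_. count_space UNIV) = count_space (PiE C (\<lambda>_. UNIV :: nat set))"
    if "finite C" for C :: "nat set"
    using that by (simp add: count_space_PiM_finite)
  have *: "{\<omega>\<in>space M. R (restrict (\<lambda>i. X i \<omega>) C)}
      = (\<lambda>\<omega>. restrict (\<lambda>i. X i \<omega>) C) -` {x \<in> PiE C (\<lambda>_. UNIV). R x} \<inter> space M" for R C
    by auto
  have "{\<omega>\<in>space M. P (restrict (\<lambda>i. X i \<omega>) A) \<and> Q (restrict (\<lambda>i. X i \<omega>) B)}
      = (\<lambda>\<omega>. (restrict (\<lambda>i. X i \<omega>) A, restrict (\<lambda>i. X i \<omega>) B)) -`
          ({x \<in> PiE A (\<lambda>_. UNIV). P x} \<times> {x \<in> PiE B (\<lambda>_. UNIV). Q x}) \<inter> space M"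
    by auto
  then show ?thesis
    unfolding *[of P] *[of Q]
    by (simp only:) (rule indep_varD[OF indep_var_restrict[OF indep assms(3)]], auto simp: eq assms)
qed

end

section \<open>First-step analysis of the ruin event\<close>

text \<open>The offset \<open>i\<close> counts the claims already consumed, so that the process can
  restart after its first step.\<close>

definition ruin_event :: "(nat \<Rightarrow> 'a \<Rightarrow> nat) \<Rightarrow> nat \<Rightarrow> nat \<Rightarrow> nat \<Rightarrow> 'a set" where
  "ruin_event \<eta> i n m =
    {\<omega>\<in>space M. \<exists>t\<in>{1..n}. int m + int t - (\<Sum>j=1..t. int (\<eta> (i + j) \<omega>)) \<le> 0}"

lemma ruin_event_restrict:
  "ruin_event \<eta> i n m = {\<omega>\<in>space M. \<exists>t\<in>{1..n}.
     int m + int t - (\<Sum>j=1..t. int (restrict (\<lambda>j. \<eta> j \<omega>) {i+1..i+n} (i + j))) \<le> 0}"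
proof -
  have "(\<Sum>j=1..t. int (restrict (\<lambda>j. \<eta> j \<omega>) {i+1..i+n} (i + j))) = (\<Sum>j=1..t. int (\<eta> (i + j) \<omega>))"
    if "t \<in> {1..n}" for t \<omega>
    using that by (intro sum.cong) auto
  then show ?thesis unfolding ruin_event_def by auto
qed

text \<open>A first claim above \<open>m\<close> ruins at once; otherwise the process restarts from
  the positive level \<open>Suc m - k\<close> with the later claims.\<close>

lemma ruin_event_Suc:
  assumes "m \<ge> 1"
  shows "ruin_event \<eta> i (Suc n) m = (\<Union>k. {\<omega>\<in>space M. \<eta> (Suc i) \<omega> = k} \<inter>
     (if k \<le> m then ruin_event \<eta> (Suc i) n (Suc m - k) else space M))"
proof -
  have one_step: "(\<exists>t\<in>{1..Suc n}. int m + int t - (\<Sum>j=1..t. int (\<eta> (i + j) \<omega>)) \<le> 0) \<longleftrightarrow>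
      (\<eta> (Suc i) \<omega> \<le> m \<longrightarrow> (\<exists>t\<in>{1..n}. int (Suc m - \<eta> (Suc i) \<omega>) + int t
          - (\<Sum>j=1..t. int (\<eta> (Suc i + j) \<omega>)) \<le> 0))" (is "?L \<longleftrightarrow> ?R") for \<omega>
  proof -
    define k where "k = \<eta> (Suc i) \<omega>"
    have shift: "int m + int (Suc t) - (\<Sum>j=1..Suc t. int (\<eta> (i + j) \<omega>)) =
        int m + 1 - int k + int t - (\<Sum>j=1..t. int (\<eta> (Suc i + j) \<omega>))" for t
    proof -
      have "(\<Sum>j=1..Suc t. int (\<eta> (i + j) \<omega>)) = int k + (\<Sum>j=2..Suc t. int (\<eta> (i + j) \<omega>))"
        by (subst sum.atLeast_Suc_atMost) (auto simp: k_def numeral_2_eq_2)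
      also have "(\<Sum>j=2..Suc t. int (\<eta> (i + j) \<omega>)) = (\<Sum>j=1..t. int (\<eta> (Suc i + j) \<omega>))"
        using sum.shift_bounds_cl_Suc_ivl[of "\<lambda>j. int (\<eta> (i + j) \<omega>)" 1 t]
        by (simp add: numeral_2_eq_2)
      finally show ?thesis by linarith
    qed
    have bex_shift: "(\<exists>t\<in>{1..Suc n}. P t) \<longleftrightarrow> (\<exists>t\<in>{0..n}. P (Suc t))" for P
    proof
      assume "\<exists>t\<in>{1..Suc n}. P t"
      then obtain t where "t \<in> {1..Suc n}" "P t" ..
      then have "t - 1 \<in> {0..n}" "P (Suc (t - 1))" by auto
      then show "\<exists>t\<in>{0..n}. P (Suc t)" ..
    next
      assume "\<exists>t\<in>{0..n}. P (Suc t)"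
      then obtain t where "t \<in> {0..n}" "P (Suc t)" ..
      then have "Suc t \<in> {1..Suc n}" "P (Suc t)" by auto
      then show "\<exists>t\<in>{1..Suc n}. P t" by (rule bexI[rotated])
    qed
    have "?L \<longleftrightarrow> (\<exists>t\<in>{0..n}. int m + int (Suc t) - (\<Sum>j=1..Suc t. int (\<eta> (i + j) \<omega>)) \<le> 0)"
      by (rule bex_shift)
    also have "\<dots> \<longleftrightarrow> (\<exists>t\<in>{0..n}. int m + 1 - int k + int t - (\<Sum>j=1..t. int (\<eta> (Suc i + j) \<omega>)) \<le> 0)"
      unfolding shift ..
    \<comment> \<open>Index 0 is the moment right after the first claim.\<close>
    also have "\<dots> \<longleftrightarrow> int m + 1 \<le> int k \<or>
        (\<exists>t\<in>{1..n}. int m + 1 - int k + int t - (\<Sum>j=1..t. int (\<eta> (Suc i + j) \<omega>)) \<le> 0)"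
    proof -
      have *: "{0..n} = insert 0 {1..n}" by auto
      have "int m + 1 - int k + int 0 - (\<Sum>j=1..0. int (\<eta> (Suc i + j) \<omega>)) \<le> 0 \<longleftrightarrow> int m + 1 \<le> int k"
        by simp
      then show ?thesis unfolding * by blast
    qed
    also have "\<dots> \<longleftrightarrow> ?R"
    proof (cases "k \<le> m")
      case True
      then have *: "int (Suc m - k) = int m + 1 - int k" "\<not> int m + 1 \<le> int k" by auto
      show ?thesis unfolding k_def[symmetric] *(1) using True *(2) by blast
    next
      case False
      then show ?thesis by (simp add: k_def[symmetric])
    qed
    finally show ?thesis .
  qed
  define C where "C k = (if k \<le> m then ruin_event \<eta> (Suc i) n (Suc m - k) else space M)" for k
  have C: "\<omega> \<in> C k \<longleftrightarrow> (k \<le> m \<longrightarrow> \<omega> \<in> ruin_event \<eta> (Suc i) n (Suc m - k))"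
    if "\<omega> \<in> space M" for k \<omega>
    using that by (simp add: C_def)
  have "\<omega> \<in> ruin_event \<eta> i (Suc n) m \<longleftrightarrow> \<omega> \<in> space M \<and> \<omega> \<in> C (\<eta> (Suc i) \<omega>)" for \<omega>
    using C[of \<omega> "\<eta> (Suc i) \<omega>"] unfolding ruin_event_def mem_Collect_eq one_step by blast
  then show ?thesis unfolding C_def[symmetric] by blast
qed

text \<open>The first claim is independent of those after it, and equal laws make the result free of
  \<open>i\<close>; hence the induction over all offsets.\<close>

lemma prob_ruin_event:
  assumes iid: "iid_nat \<eta>" and "m \<ge> 1"
  shows "prob (ruin_event \<eta> i n m) = finite_ruin (\<lambda>k. prob {\<omega>\<in>space M. \<eta> 0 \<omega> = k}) n m"
  using \<open>m \<ge> 1\<close>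
proof (induction n arbitrary: i m)
  case 0
  then show ?case by (simp add: ruin_event_def finite_ruin_0)
next
  case (Suc n)
  let ?f = "\<lambda>k. prob {\<omega>\<in>space M. \<eta> 0 \<omega> = k}"
  let ?A = "\<lambda>k. {\<omega>\<in>space M. \<eta> (Suc i) \<omega> = k}"
  let ?B = "\<lambda>k. if k \<le> m then ruin_event \<eta> (Suc i) n (Suc m - k) else space M"
  have indep: "indep_vars (\<lambda>_. count_space UNIV) \<eta> UNIV"
    and distr: "distr M (count_space UNIV) (\<eta> j) = distr M (count_space UNIV) (\<eta> 0)" for j
    using iid by (auto simp: iid_nat_def)
  have rv: "\<eta> j \<in> measurable M (count_space UNIV)" for j
    using indep by (auto simp: indep_vars_def)
  have A: "prob (?A k) = ?f k" for k
    using arg_cong[OF distr[of "Suc i"], of "\<lambda>N. measure N {k}"] rv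
    by (simp add: measure_distr vimage_def Int_def conj_commute)
  have ev: "ruin_event \<eta> j n' m' \<in> events" for j n' m'
    unfolding ruin_event_restrict by (rule finite_dim_events[OF indep]) simp
  have Aev: "?A k \<in> events" for k using rv by measurable
  have AB: "prob (?A k \<inter> ?B k) = ?f k * finite_ruin ?f n (Suc m - k)" for k
  proof (cases "k \<le> m")
    case True
    define P where "P x \<longleftrightarrow> x (Suc i) = k" for x :: "nat \<Rightarrow> nat"
    define Q where "Q x \<longleftrightarrow> (\<exists>t\<in>{1..n}. int (Suc m - k) + int t - (\<Sum>j=1..t. int (x (Suc i + j))) \<le> 0)"
      for x :: "nat \<Rightarrow> nat"
    have P: "?A k = {\<omega>\<in>space M. P (restrict (\<lambda>j. \<eta> j \<omega>) {Suc i})}"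
      by (simp add: P_def)
    have Q: "ruin_event \<eta> (Suc i) n (Suc m - k) = {\<omega>\<in>space M. Q (restrict (\<lambda>j. \<eta> j \<omega>) {Suc i+1..Suc i+n})}"
      unfolding ruin_event_restrict Q_def ..
    have "?A k \<inter> ruin_event \<eta> (Suc i) n (Suc m - k) = {\<omega>\<in>space M.
        P (restrict (\<lambda>j. \<eta> j \<omega>) {Suc i}) \<and> Q (restrict (\<lambda>j. \<eta> j \<omega>) {Suc i+1..Suc i+n})}"
      unfolding P Q by blast
    also have "prob \<dots> = prob (?A k) * prob (ruin_event \<eta> (Suc i) n (Suc m - k))"
      unfolding P Q by (rule finite_dim_indep[OF indep]) auto
    finally have "prob (?A k \<inter> ruin_event \<eta> (Suc i) n (Suc m - k)) =
      prob (?A k) * prob (ruin_event \<eta> (Suc i) n (Suc m - k))" .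
    then show ?thesis using True A Suc.IH[of "Suc m - k" "Suc i"] by simp
  next
    case False
    \<comment> \<open>Certain ruin matches the value 1 of \<open>finite_ruin\<close> at the
      truncated level 0.\<close>
    then have "Suc m - k = 0" "?A k \<inter> ?B k = ?A k" by auto
    then show ?thesis by (simp only: A finite_ruin_at_0 mult_1_right)
  qed
  have "(\<lambda>k. prob (?A k \<inter> ?B k)) sums prob (\<Union>k. ?A k \<inter> ?B k)"
  proof (rule finite_measure_UNION)
    show "range (\<lambda>k. ?A k \<inter> ?B k) \<subseteq> events" using Aev ev by auto
    show "disjoint_family (\<lambda>k. ?A k \<inter> ?B k)" unfolding disjoint_family_on_def by blast
  qed
  then show ?case
    using Suc.prems by (simp only: AB ruin_event_Suc finite_ruin_Suc sums_iff)
qed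

text \<open>Ruin in finite time is the increasing union of ruin within the horizons; continuity from
  below applies.\<close>

lemma ruin_probability_limit:
  assumes iid: "iid_nat \<eta>" and "m \<ge> 1"
  shows "(\<lambda>n. finite_ruin (\<lambda>k. prob {\<omega>\<in>space M. \<eta> 0 \<omega> = k}) n m) \<longlonglongrightarrow> ruin_probability \<eta> m"
proof -
  have indep: "indep_vars (\<lambda>_. count_space UNIV) \<eta> UNIV"
    using iid by (auto simp: iid_nat_def)
  have ev: "ruin_event \<eta> 0 n m \<in> events" for n
    unfolding ruin_event_restrict by (rule finite_dim_events[OF indep]) simp
  have "ruin_event \<eta> 0 n m \<subseteq> ruin_event \<eta> 0 (Suc n) m" for n
  proof -
    have "{1..n} \<subseteq> {1..Suc n}" by auto
    then show ?thesis unfolding ruin_event_def by blast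
  qed
  then have "incseq (\<lambda>n. ruin_event \<eta> 0 n m)" by (rule incseq_SucI)
  then have "(\<lambda>n. prob (ruin_event \<eta> 0 n m)) \<longlonglongrightarrow> prob (\<Union>n. ruin_event \<eta> 0 n m)"
    using ev by (intro finite_Lim_measure_incseq) auto
  moreover have "(\<Union>n. ruin_event \<eta> 0 n m) = {\<omega> \<in> space M. ruin_time \<eta> m \<omega> < \<infinity>}"
  proof -
    have "ruin_time \<eta> m \<omega> < \<infinity> \<longleftrightarrow> (\<exists>t\<ge>1. risk_process \<eta> m t \<omega> \<le> 0)" for \<omega>
      unfolding ruin_time_def Inf_less_iff by auto
    moreover have "(\<exists>n. \<exists>t\<in>{1..n}. R t) \<longleftrightarrow> (\<exists>t\<ge>1. R t)" for R :: "nat \<Rightarrow> bool"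
      by (metis atLeastAtMost_iff order_refl)
    ultimately have *: "ruin_time \<eta> m \<omega> < \<infinity> \<longleftrightarrow> (\<exists>n. \<exists>t\<in>{1..n}. risk_process \<eta> m t \<omega> \<le> 0)" for \<omega>
      by (simp only:)
    show ?thesis
      unfolding * ruin_event_def risk_process_def add_0 by blast
  qed
  ultimately show ?thesis
    using assms by (simp add: prob_ruin_event ruin_probability_def)
qed

text \<open>The law of \<open>X\<close> has its masses as density against counting measure, so
  expectations become series.\<close>

lemma expectation_sums:
  fixes X :: "'a \<Rightarrow> nat" and g :: "nat \<Rightarrow> real"
  assumes X: "X \<in> measurable M (count_space UNIV)" and int: "integrable M (\<lambda>\<omega>. g (X \<omega>))"
  shows "(\<lambda>k. g k * prob {\<omega>\<in>space M. X \<omega> = k}) sums expectation (\<lambda>\<omega>. g (X \<omega>))"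
proof -
  let ?f = "\<lambda>k. prob {\<omega>\<in>space M. X \<omega> = k}"
  have D: "distr M (count_space UNIV) X = density (count_space UNIV) ?f"
  proof (rule measure_eqI_countable)
    show "emeasure (distr M (count_space UNIV) X) {k} = emeasure (density (count_space UNIV) ?f) {k}" for k
      using X by (simp add: emeasure_distr emeasure_density emeasure_eq_measure vimage_def Int_def conj_commute)
  qed auto
  have "integrable (density (count_space UNIV) ?f) g"
    using int X by (simp flip: D add: integrable_distr_eq)
  then have "integrable (count_space UNIV) (\<lambda>k. ?f k * g k)"
    by (subst (asm) integrable_real_density) auto
  then have "(\<lambda>k. ?f k * g k) sums integral\<^sup>L (count_space UNIV) (\<lambda>k. ?f k * g k)"
    by (rule sums_integral_count_space_nat)
  also have "integral\<^sup>L (count_space UNIV) (\<lambda>k. ?f k * g k) = integral\<^sup>L (density (count_space UNIV) ?f) g"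
    by (subst integral_real_density) auto
  also have "\<dots> = expectation (\<lambda>\<omega>. g (X \<omega>))"
    using X by (simp flip: D add: integral_distr)
  finally show ?thesis by (simp add: mult.commute)
qed

end

section \<open>Factorial moments as masses of iterated tails\<close>

lemma sum_linear: "(\<Sum>k<n. real k) = real n * (real n - 1) / 2"
  by (induction n) (auto simp: field_simps)

lemma sum_quadratic:
  "(\<Sum>k<n. real k * (real k - 1) / 2) = real n * (real n - 1) * (real n - 2) / 6"
  by (induction n) (auto simp: field_simps)

text \<open>Where a factor is negative, another one vanishes.\<close>

lemma of_nat_falling_nonneg: "0 \<le> real n * (real n - 1)" "0 \<le> real n * (real n - 1) * (real n - 2)"
proof -
  consider "n = 0" | "n = 1" | "n \<ge> 2" by linarith
  then show "0 \<le> real n * (real n - 1)" "0 \<le> real n * (real n - 1) * (real n - 2)"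
    by (cases; simp)+
qed

context claim_law
begin

lemma second_moment_sums:
  assumes "(\<lambda>k. real k * (real k - 1) * f k) sums \<mu>"
  shows "(\<lambda>k. real k * b k) sums (\<mu> / 2)"
proof -
  have *: "(\<lambda>j. (\<Sum>k<j. real k) * f j) sums (\<mu> / 2)"
    using sums_divide[OF assms, of 2] by (simp add: sum_linear)
  show ?thesis
    using tail_weighted_sums[of f real, OF f_nonneg f_summable] * by (simp add: sums_iff)
qed

text \<open>Each tail raises the binomial weight by one degree: the weight 1 on the second tail of
  \<open>b\<close> becomes \<open>k\<close> on the first, k choose 2 on \<open>b\<close> and k
  choose 3 on \<open>f\<close>.\<close>

lemma third_moment_sums:
  assumes "(\<lambda>k. real k * (real k - 1) * f k) sums \<mu>"
    and "(\<lambda>k. real k * (real k - 1) * (real k - 2) * f k) sums \<nu>"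
  shows "tail (tail b) sums (\<nu> / 6)"
proof -
  have "(\<lambda>j. (\<Sum>k<j. real k * (real k - 1) / 2) * f j) sums (\<nu> / 6)"
    using sums_divide[OF assms(2), of 6] by (simp add: sum_quadratic)
  then have "(\<lambda>j. (\<Sum>k<j. real k) * b j) sums (\<nu> / 6)"
    using tail_weighted_sums[of f "\<lambda>k. real k * (real k - 1) / 2", OF f_nonneg f_summable]
    by (simp add: sums_iff sum_linear of_nat_falling_nonneg)
  then have "(\<lambda>k. real k * tail b k) sums (\<nu> / 6)"
    using tail_weighted_sums[of b real, OF b_nonneg b_summable] by (simp add: sums_iff)
  moreover have "summable (tail b)"
    using tail_b_sums second_moment_sums[OF assms(1)] by (auto simp: sums_iff)
  ultimately show ?thesis
    using tail_weighted_sums[of "tail b" "\<lambda>_. 1", OF tail_nonneg[OF b_nonneg b_summable]]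
    by (simp add: sums_iff)
qed

end

section \<open>Transfer to the random claims, and the bounds\<close>

theorem theorem3p4:
  fixes M :: "'a measure" and \<eta> :: "nat \<Rightarrow> 'a \<Rightarrow> nat"
    and q p\<^sub>0 p \<mu>\<^sub>2 \<mu>\<^sub>3 v :: real and \<psi> :: "nat \<Rightarrow> real"
  assumes "prob_space M"
    and iid: "prob_space.iid_nat M \<eta>"
    and mean: "integrable M (\<lambda>\<omega>. real (\<eta> 0 \<omega>))"
    and q: "q = prob_space.expectation M (\<lambda>\<omega>. real (\<eta> 0 \<omega>))" "q < 1"
    and p\<^sub>0: "p\<^sub>0 = prob_space.prob M {\<omega> \<in> space M. \<eta> 0 \<omega> = 0}"
    and p: "p = prob_space.prob M {\<omega> \<in> space M. \<eta> 0 \<omega> > 0}"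
    and \<mu>\<^sub>2: "\<mu>\<^sub>2 = prob_space.expectation M
                 (\<lambda>\<omega>. real (\<eta> 0 \<omega>) * (real (\<eta> 0 \<omega>) - 1))"
    and \<mu>\<^sub>3: "\<mu>\<^sub>3 = prob_space.expectation M
                 (\<lambda>\<omega>. real (\<eta> 0 \<omega>) * (real (\<eta> 0 \<omega>) - 1) * (2 * real (\<eta> 0 \<omega>) - 1))"
    and v: "v = sqrt (-4 * (q - p) / ((2 * q - 3 * p) * ln ((q - p) / p\<^sub>0)))"
    and \<psi>: "\<psi> = prob_space.ruin_probability M \<eta>"
  shows "\<forall>m\<ge>1.
     ((q - p) / p\<^sub>0) ^ m \<le> \<psi> m \<and>
     (integrable M (\<lambda>\<omega>. real (\<eta> 0 \<omega>) ^ 2) \<longrightarrow>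
        \<psi> m \<le> ((q - p) / p\<^sub>0) ^ m + 1 / p\<^sub>0 * (1 / 2 * \<mu>\<^sub>2 - q + p)) \<and>
     (integrable M (\<lambda>\<omega>. real (\<eta> 0 \<omega>) ^ 3) \<and> \<mu>\<^sub>2 > 0 \<longrightarrow>
        \<bar>\<psi> m - (\<mu>\<^sub>2 / (2 * (1 - q) + \<mu>\<^sub>2)) ^ m\<bar>
          \<le> 1 / 2 * (if 2 * q > 3 * p then min 1 ((1 - q) * (1 + v) / p\<^sub>0) else 1)
              * (\<mu>\<^sub>3 / (3 * \<mu>\<^sub>2) - 1))"
proof -
  interpret prob_space M by fact
  define f where "f k = prob {\<omega> \<in> space M. \<eta> 0 \<omega> = k}" for k
  have X: "\<eta> 0 \<in> measurable M (count_space UNIV)"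
    using iid by (auto simp: iid_nat_def indep_vars_def)
  have E: "(\<lambda>k. g k * f k) sums expectation (\<lambda>\<omega>. g (\<eta> 0 \<omega>))"
    if "integrable M (\<lambda>\<omega>. g (\<eta> 0 \<omega>))" for g :: "nat \<Rightarrow> real"
    unfolding f_def by (rule expectation_sums[OF X that])
  interpret claim_law f q
  proof
    show "f sums 1" using E[of "\<lambda>_. 1"] by (simp add: prob_space)
    show "(\<lambda>k. real k * f k) sums q" using E[of real, OF mean] q(1) by simp
  qed (simp_all add: f_def q(2))
  have p0': "p\<^sub>0 = f 0" by (simp add: p\<^sub>0 f_def)
  have "{\<omega> \<in> space M. \<eta> 0 \<omega> = 0} \<in> events" using X by measurable
  from prob_neg[OF this] have p': "p = b 0" by (simp add: p b_0 f_def)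
  have \<rho>: "(q - p) / p\<^sub>0 = \<rho>" by (simp add: \<rho>_def p0' p')
  have \<psi>: "\<psi> m = \<Psi> m" if "m \<ge> 1" for m
    using LIMSEQ_unique[OF \<Psi>_tendsto ruin_probability_limit[OF iid that, folded f_def]] \<psi> by simp
  have \<mu>2_sums: "(\<lambda>k. real k * (real k - 1) * f k) sums \<mu>\<^sub>2"
    if "integrable M (\<lambda>\<omega>. real (\<eta> 0 \<omega>) ^ 2)"
    unfolding \<mu>\<^sub>2
  proof (rule E)
    have "integrable M (\<lambda>\<omega>. real (\<eta> 0 \<omega>) ^ 2 - real (\<eta> 0 \<omega>))"
      by (intro Bochner_Integration.integrable_diff that mean)
    then show "integrable M (\<lambda>\<omega>. real (\<eta> 0 \<omega>) * (real (\<eta> 0 \<omega>) - 1))"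
      by (simp add: power2_eq_square algebra_simps)
  qed
  show ?thesis
  proof (intro allI impI conjI)
    fix m :: nat assume m: "1 \<le> m"
    show "((q - p) / p\<^sub>0) ^ m \<le> \<psi> m" using power_le_\<Psi> by (simp add: \<rho> \<psi>[OF m])
    show "\<psi> m \<le> ((q - p) / p\<^sub>0) ^ m + 1 / p\<^sub>0 * (1 / 2 * \<mu>\<^sub>2 - q + p)"
      if "integrable M (\<lambda>\<omega>. real (\<eta> 0 \<omega>) ^ 2)"
    proof -
      note B = second_moment_sums[OF \<mu>2_sums[OF that]]
      show ?thesis
        using \<Psi>_upper[OF sums_summable[OF B], of m]
        unfolding \<rho> \<psi>[OF m] sums_unique[OF B, symmetric] by (simp add: p0' p')
    qed
    assume "integrable M (\<lambda>\<omega>. real (\<eta> 0 \<omega>) ^ 3) \<and> \<mu>\<^sub>2 > 0"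
    then have i3: "integrable M (\<lambda>\<omega>. real (\<eta> 0 \<omega>) ^ 3)" and \<mu>2_pos: "\<mu>\<^sub>2 > 0" by auto
    \<comment> \<open>On the naturals the square is dominated by the cube.\<close>
    have i2: "integrable M (\<lambda>\<omega>. real (\<eta> 0 \<omega>) ^ 2)"
    proof (rule Bochner_Integration.integrable_bound[OF i3])
      have "n ^ 2 \<le> n ^ 3" for n :: nat by (cases "n = 0") (auto intro: power_increasing)
      then have "real n ^ 2 \<le> real n ^ 3" for n by (metis of_nat_mono of_nat_power)
      then show "AE \<omega> in M. norm (real (\<eta> 0 \<omega>) ^ 2) \<le> norm (real (\<eta> 0 \<omega>) ^ 3)" by simp
    qed (use X in measurable)
    define \<nu> where "\<nu> = expectation (\<lambda>\<omega>. real (\<eta> 0 \<omega>) * (real (\<eta> 0 \<omega>) - 1) * (real (\<eta> 0 \<omega>) - 2))"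
    have iL: "integrable M (\<lambda>\<omega>. real (\<eta> 0 \<omega>) * (real (\<eta> 0 \<omega>) - 1))"
      using Bochner_Integration.integrable_diff[OF i2 mean] by (simp add: power2_eq_square algebra_simps)
    have "integrable M (\<lambda>\<omega>. real (\<eta> 0 \<omega>) ^ 3 - 3 * real (\<eta> 0 \<omega>) ^ 2 + 2 * real (\<eta> 0 \<omega>))"
      using i3 i2 mean by auto
    also have "(\<lambda>\<omega>. real (\<eta> 0 \<omega>) ^ 3 - 3 * real (\<eta> 0 \<omega>) ^ 2 + 2 * real (\<eta> 0 \<omega>))
        = (\<lambda>\<omega>. real (\<eta> 0 \<omega>) * (real (\<eta> 0 \<omega>) - 1) * (real (\<eta> 0 \<omega>) - 2))"
      by (simp add: fun_eq_iff power2_eq_square power3_eq_cube algebra_simps)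
    finally have i\<nu>: "integrable M (\<lambda>\<omega>. real (\<eta> 0 \<omega>) * (real (\<eta> 0 \<omega>) - 1) * (real (\<eta> 0 \<omega>) - 2))" .
    \<comment> \<open>Write \<open>2 * x - 1\<close> as \<open>2 * (x - 2) + 3\<close> to reach
      factorial moments.\<close>
    have "\<mu>\<^sub>3 = expectation (\<lambda>\<omega>. 2 * (real (\<eta> 0 \<omega>) * (real (\<eta> 0 \<omega>) - 1) * (real (\<eta> 0 \<omega>) - 2))
        + 3 * (real (\<eta> 0 \<omega>) * (real (\<eta> 0 \<omega>) - 1)))"
      unfolding \<mu>\<^sub>3 by (rule arg_cong[where f = expectation]) (simp add: fun_eq_iff algebra_simps)
    also have "\<dots> = 2 * \<nu> + 3 * \<mu>\<^sub>2"
      unfolding \<nu>_def \<mu>\<^sub>2 using i\<nu> iL by (subst Bochner_Integration.integral_add) auto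
    finally have \<nu>: "\<mu>\<^sub>3 = 2 * \<nu> + 3 * \<mu>\<^sub>2" .
    have "(\<lambda>k. real k * (real k - 1) * (real k - 2) * f k) sums \<nu>"
      unfolding \<nu>_def by (rule E[OF i\<nu>])
    note C = third_moment_sums[OF \<mu>2_sums[OF i2] this]
    note B = second_moment_sums[OF \<mu>2_sums[OF i2]]
    have "\<nu> \<ge> 0"
      unfolding \<nu>_def by (intro integral_nonneg_AE AE_I2 of_nat_falling_nonneg)
    have r: "\<mu>\<^sub>2 / (2 * (1 - q) + \<mu>\<^sub>2) = (\<mu>\<^sub>2 / 2) / (1 - q + \<mu>\<^sub>2 / 2)"
      using q(2) \<mu>2_pos by (simp add: field_simps)
    have "\<mu>\<^sub>2 / 2 > 0" using \<mu>2_pos by simp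
    from \<Psi>_geometric[OF sums_summable[OF B] sums_summable[OF C] sums_unique[OF B] this refl m]
    have "\<bar>\<psi> m - (\<mu>\<^sub>2 / (2 * (1 - q) + \<mu>\<^sub>2)) ^ m\<bar> \<le> (1 - \<rho>) * (\<nu> / 6) / (\<mu>\<^sub>2 / 2)"
      unfolding sums_unique[OF C, symmetric] r \<psi>[OF m] .
    also have "\<dots> = 1 / 2 * (1 - \<rho>) * (\<mu>\<^sub>3 / (3 * \<mu>\<^sub>2) - 1)"
      using \<mu>2_pos by (simp add: \<nu> field_simps)
    also have "\<dots> \<le> 1 / 2 * (if 2 * q > 3 * p then min 1 ((1 - q) * (1 + v) / p\<^sub>0) else 1)
              * (\<mu>\<^sub>3 / (3 * \<mu>\<^sub>2) - 1)"
    proof (intro mult_right_mono mult_left_mono)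
      show "0 \<le> \<mu>\<^sub>3 / (3 * \<mu>\<^sub>2) - 1" using \<mu>2_pos \<open>\<nu> \<ge> 0\<close> by (simp add: \<nu> field_simps)
      have "(1 - q) * 1 / p\<^sub>0 \<le> (1 - q) * (1 + v) / p\<^sub>0" if "2 * q > 3 * p"
      proof -
        \<comment> \<open>The default \<open>ln 0 = 0\<close> covers \<open>\<rho> = 0\<close>.
          Numerator and denominator under the root are then both nonpositive, so
          \<open>v \<ge> 0\<close>.\<close>
        have "ln \<rho> \<le> 0" using \<rho>_nonneg \<rho>_less_1 by (cases "\<rho> = 0") auto
        then have "0 \<le> v"
          unfolding v \<rho> using that b_0_le p'
          by (intro real_sqrt_ge_zero divide_nonpos_nonpos) (auto intro: mult_nonneg_nonpos)
        then show ?thesis using q(2) f_0_pos p0' by (intro divide_right_mono mult_left_mono) auto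
      qed
      \<comment> \<open>Here \<open>1 - \<rho> = (1 - q) / p\<^sub>0\<close>, which is at most
        1.\<close>
      then show "1 - \<rho> \<le> (if 2 * q > 3 * p then min 1 ((1 - q) * (1 + v) / p\<^sub>0) else 1)"
        using one_minus_\<rho> \<rho>_nonneg p0' by auto
    qed simp
    finally show "\<bar>\<psi> m - (\<mu>\<^sub>2 / (2 * (1 - q) + \<mu>\<^sub>2)) ^ m\<bar>
          \<le> 1 / 2 * (if 2 * q > 3 * p then min 1 ((1 - q) * (1 + v) / p\<^sub>0) else 1)
              * (\<mu>\<^sub>3 / (3 * \<mu>\<^sub>2) - 1)" .
  qed
qed

end
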